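(* For every $n \geqslant 2$ there exists a 2DFA with $n$ states which accepts at least one string and whose shortest accepted string has length exactly $3 \cdot 2^{n-2} - 1$.
   Context: A two-way deterministic finite automaton (2DFA) is a quintuple $(\Sigma, Q, q_0, \delta, F)$ where $\Sigma$ is a finite alphabet not containing the end-markers $\vdash$ and $\dashv$, $Q$ is a finite set of states, $q_0 \in Q$ is the initial state, $\delta: Q \times (\Sigma \cup \{\vdash, \dashv\}) \to Q \times \{-1,+1\}$ is a partial transition function, and $F \subseteq Q$ is the set of accepting states. On input $w = a_1 \cdots a_m \in \Sigma^*$ the automaton works on the tape $\vdash a_1 \cdots a_m \dashv$, starting at $\vdash$ in state $q_0$; in state $q$ reading symbol $c$, if $\delta(q,c) = (r,d)$ it enters state $r$ and moves one cell in direction $d$ ($-1$ left, $+1$ right); if $\delta(q,c)$ is undefined it rejects. It accepts $w$ if it ever arrives at $\dashv$ in a state from $F$; it may also loop forever (not accepting). The number of states of the automaton is $|Q|$. *)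

theory Defs
  imports Main
begin

datatype 'a tsym = LEnd | REnd | Letter 'a

record twodfa =
  Sigma :: "nat set"
  States :: "nat set"
  init :: nat
  delta :: "nat \<Rightarrow> nat tsym \<Rightarrow> (nat \<times> int) option"
  Final :: "nat set"

definition wf_twodfa :: "twodfa \<Rightarrow> bool" where
  "wf_twodfa A \<longleftrightarrow>
     finite (Sigma A) \<and> finite (States A) \<and> init A \<in> States A \<and> Final A \<subseteq> States A \<and>
     (\<forall>q c r d. delta A q c = Some (r, d) \<longrightarrow>
        q \<in> States A \<and> c \<in> {LEnd, REnd} \<union> Letter ` Sigma A \<and>
        r \<in> States A \<and> d \<in> {-1, 1})"

definition tape :: "'a list \<Rightarrow> nat \<Rightarrow> 'a tsym" where
  "tape w i = (if i = 0 then LEnd else if i = Suc (length w) then REnd else Letter (w ! (i - 1)))"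

text \<open>One computation step on configurations (state, head position).  A move leaving the
  tape is not a step (the automaton halts without accepting).\<close>
definition step :: "twodfa \<Rightarrow> nat list \<Rightarrow> nat \<times> nat \<Rightarrow> nat \<times> nat \<Rightarrow> bool" where
  "step A w c c' \<longleftrightarrow>
     (\<exists>r d. delta A (fst c) (tape w (snd c)) = Some (r, d) \<and>
            0 \<le> int (snd c) + d \<and> int (snd c) + d \<le> int (length w) + 1 \<and>
            c' = (r, nat (int (snd c) + d)))"

definition accepts :: "twodfa \<Rightarrow> nat list \<Rightarrow> bool" where
  "accepts A w \<longleftrightarrow> set w \<subseteq> Sigma A \<and>
     (\<exists>q \<in> Final A. (step A w)\<^sup>*\<^sup>* (init A, 0) (q, Suc (length w)))"

end

theory Submission
  imports Defs "HOL-Library.Countable"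
begin

text \<open>The states are \<open>0..N\<close>. There are two tasks for each \<open>k\<close>: to move the head forward from state
  \<open>k\<close> to state \<open>N\<close>, and to produce a prefix that answers the request \<open>k\<close> (the head enters the prefix
  from the right in state \<open>k\<close>) by leaving to the right in state \<open>N\<close>. Each of them is solved by first
  solving the second task for \<open>Suc k\<close>, then by a letter on which \<open>k\<close> sends the request \<open>Suc k\<close> and
  turns the answer \<open>N\<close> into \<open>Suc k\<close>, and then by solving the first task for \<open>Suc k\<close>; meanwhile, the
  letters pass \<open>k\<close> to the right, or to the left, or block it. So the cost nearly doubles with each
  new state. Conversely, the progress in this recursion can be read off from the state of the head
  and from the answers of an arbitrary prefix, and no letter increases it by more than one.\<close>

section \<open>Crossing behaviour of two-way automata\<close>

text \<open>Visits to one cell until it is left to the right: \<open>t\<close> acts on the cell,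
  \<open>g\<close> stands for the prefix to its left. Being inductive, the relation has no pair for
  a loop.\<close>

inductive cross :: "(nat \<Rightarrow> (nat \<times> int) option) \<Rightarrow> (nat \<Rightarrow> nat \<Rightarrow> bool) \<Rightarrow> nat \<Rightarrow> nat \<Rightarrow> bool"
  for t g where
  right: "t p = Some (q, 1) \<Longrightarrow> cross t g p q"
| left: "t p = Some (p', -1) \<Longrightarrow> g p' p'' \<Longrightarrow> cross t g p'' q \<Longrightarrow> cross t g p q"

text \<open>Prefixes are reversed: the head of the list is the letter next to the boundary. The relation
  \<open>ret A u\<close> describes entering the prefix from the right in one state and leaving it in another.\<close>

fun ret :: "twodfa \<Rightarrow> nat list \<Rightarrow> nat \<Rightarrow> nat \<Rightarrow> bool" where
  "ret A [] = cross (\<lambda>p. delta A p LEnd) (\<lambda>_ _. False)"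
| "ret A (a # u) = cross (\<lambda>p. delta A p (Letter a)) (ret A u)"

text \<open>\<open>q\<close> is the state in which the head first leaves the prefix to the
  right.\<close>

fun front :: "twodfa \<Rightarrow> nat list \<Rightarrow> nat \<Rightarrow> bool" where
  "front A [] q = ret A [] (init A) q"
| "front A (a # u) q = (\<exists>p. front A u p \<and> ret A (a # u) p q)"

lemma tape_Suc: "k < length w \<Longrightarrow> tape w (Suc k) = Letter (w ! k)"
  by (simp add: tape_def)

lemma rev_take_Suc: "k < length w \<Longrightarrow> rev (take (Suc k) w) = w ! k # rev (take k w)"
  by (simp add: take_Suc_conv_app_nth)

lemma ret_rev_take:
  "k \<le> length w \<Longrightarrow> ret A (rev (take k w)) =
     cross (\<lambda>p. delta A p (tape w k)) (if k = 0 then (\<lambda>_ _. False) else ret A (rev (take (k - 1) w)))"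
  by (cases k) (simp_all add: rev_take_Suc tape_Suc tape_def)

lemma stepI_right:
  "delta A p (tape w k) = Some (q, 1) \<Longrightarrow> k \<le> length w \<Longrightarrow> step A w (p, k) (q, Suc k)"
  unfolding step_def by force

lemma stepI_left:
  "delta A p (tape w (Suc k)) = Some (q, -1) \<Longrightarrow> k \<le> length w \<Longrightarrow> step A w (p, Suc k) (q, k)"
  unfolding step_def by force

lemma ret_imp_steps:
  "k \<le> length w \<Longrightarrow> ret A (rev (take k w)) p q \<Longrightarrow> (step A w)\<^sup>*\<^sup>* (p, k) (q, Suc k)"
proof (induction k arbitrary: p q)
  case 0
  have "cross (\<lambda>p. delta A p (tape w 0)) (\<lambda>_ _. False) p q"
    using 0 by (simp add: tape_def)
  then show ?case
    by cases (auto intro: stepI_right)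
next
  case (Suc k)
  have "cross (\<lambda>p. delta A p (tape w (Suc k))) (ret A (rev (take k w))) p q"
    using Suc.prems ret_rev_take[of "Suc k" w A] by simp
  then show ?case
  proof induction
    case (right p q)
    then show ?case using Suc.prems by (auto intro: stepI_right)
  next
    case (left p p' p'' q)
    have "step A w (p, Suc k) (p', k)"
      using left Suc.prems by (auto intro: stepI_left)
    moreover have "(step A w)\<^sup>*\<^sup>* (p', k) (p'', Suc k)"
      using left Suc by simp
    ultimately show ?case using left.IH by simp
  qed
qed

lemma front_imp_steps:
  "k \<le> length w \<Longrightarrow> front A (rev (take k w)) q \<Longrightarrow> (step A w)\<^sup>*\<^sup>* (init A, 0) (q, Suc k)"
proof (induction k arbitrary: q)
  case 0
  then show ?case using ret_imp_steps[of 0 w A] by simp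
next
  case (Suc k)
  then obtain p where "front A (rev (take k w)) p" "ret A (rev (take (Suc k) w)) p q"
    by (auto simp: rev_take_Suc)
  then have "(step A w)\<^sup>*\<^sup>* (init A, 0) (p, Suc k)" "(step A w)\<^sup>*\<^sup>* (p, Suc k) (q, Suc (Suc k))"
    using Suc ret_imp_steps[of "Suc k" w A p q] by simp_all
  then show ?case by simp
qed

section \<open>From runs back to crossing relations\<close>

definition step_upto :: "twodfa \<Rightarrow> nat list \<Rightarrow> nat \<Rightarrow> nat \<times> nat \<Rightarrow> nat \<times> nat \<Rightarrow> bool" where
  "step_upto A w k c c' \<longleftrightarrow> step A w c c' \<and> snd c \<le> k"

lemma step_cases:
  assumes "wf_twodfa A" "step A w (p, i) c"
  obtains q where "delta A p (tape w i) = Some (q, 1)" "c = (q, Suc i)"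
  | q j where "delta A p (tape w i) = Some (q, -1)" "i = Suc j" "c = (q, j)"
proof -
  obtain r d where rd: "delta A p (tape w i) = Some (r, d)" "0 \<le> int i + d" "c = (r, nat (int i + d))"
    using assms(2) unfolding step_def by auto
  then have "d = -1 \<or> d = 1"
    using assms(1) unfolding wf_twodfa_def by blast
  then show thesis
  proof
    assume "d = 1"
    then show thesis using rd that(1)[of r] by (simp add: nat_add_distrib)
  next
    assume d: "d = -1"
    then obtain j where "i = Suc j" using rd by (cases i) auto
    then show thesis using rd d that(2)[of r j] by simp
  qed
qed

text \<open>A move changes the position by one, so the run must enter \<open>Suc j\<close>; until
  its first arrival there, every step starts at or left of \<open>j\<close>.\<close>

lemma first_crossing:
  assumes "wf_twodfa A" "i \<le> j" "j \<le> k" "(step_upto A w k ^^ m) (p, i) (q, Suc k)"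
  shows "\<exists>m1 m2 r. m1 + m2 = m \<and> (step_upto A w j ^^ m1) (p, i) (r, Suc j) \<and>
           (step_upto A w k ^^ m2) (r, Suc j) (q, Suc k)"
  using assms(2,4)
proof (induction m arbitrary: p i)
  case 0
  then show ?case using assms(3) by simp
next
  case (Suc m)
  then obtain p1 i1 where c: "step_upto A w k (p, i) (p1, i1)" "(step_upto A w k ^^ m) (p1, i1) (q, Suc k)"
    by (metis relpowp_Suc_D2 surj_pair)
  have l: "step_upto A w j (p, i) (p1, i1)"
    using c Suc.prems by (simp add: step_upto_def)
  have "i1 \<le> Suc i"
    using c(1) assms(1) unfolding step_upto_def by (auto elim: step_cases)
  then consider "i1 = Suc j" | "i1 \<le> j" using Suc.prems by linarith
  then show ?case
  proof cases
    case 1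
    have "(step_upto A w j ^^ 1) (p, i) (p1, Suc j)" using l 1 by auto
    then show ?thesis using c 1 by (metis plus_1_eq_Suc)
  next
    case 2
    then obtain m1 m2 r where r: "m1 + m2 = m" "(step_upto A w j ^^ m1) (p1, i1) (r, Suc j)"
      "(step_upto A w k ^^ m2) (r, Suc j) (q, Suc k)"
      using Suc.IH c by blast
    then have "(step_upto A w j ^^ Suc m1) (p, i) (r, Suc j)"
      using l by (metis relpowp_Suc_I2)
    then show ?thesis using r by (metis add_Suc)
  qed
qed

text \<open>Strong induction on the number of steps: after a move to the left, the first return to
  \<open>k\<close> splits the rest into two shorter runs.\<close>

lemma steps_imp_ret:
  assumes "wf_twodfa A"
  shows "k \<le> length w \<Longrightarrow> (step_upto A w k ^^ m) (p, k) (q, Suc k) \<Longrightarrow> ret A (rev (take k w)) p q"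
proof (induction m arbitrary: k p q rule: less_induct)
  case (less m)
  obtain m' where m: "m = Suc m'"
    using less.prems(2) by (cases m) auto
  then obtain c where c: "step_upto A w k (p, k) c" "(step_upto A w k ^^ m') c (q, Suc k)"
    using less.prems(2) by (metis relpowp_Suc_D2)
  note ret_eq = ret_rev_take[OF less.prems(1), of A]
  have "step A w (p, k) c" using c by (simp add: step_upto_def)
  with assms show ?case
  proof (cases rule: step_cases)
    case (1 r)
    have "m' = 0"
    proof (rule ccontr)
      assume "m' \<noteq> 0"
      then obtain m'' where "m' = Suc m''" by (cases m') auto
      then obtain c' where "step_upto A w k c c'" using c(2) by (metis relpowp_Suc_D2)
      then show False using 1 by (simp add: step_upto_def)
    qed
    then show ?thesis using 1 c ret_eq by (auto intro: cross.right)
  next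
    case (2 r j)
    have "(step_upto A w k ^^ m') (r, j) (q, Suc k)" using c 2 by simp
    then obtain m1 m2 s where s: "m1 + m2 = m'" "(step_upto A w j ^^ m1) (r, j) (s, Suc j)"
      "(step_upto A w k ^^ m2) (s, k) (q, Suc k)"
      using first_crossing[OF assms, of j j k m' w r q] 2 by auto
    have "ret A (rev (take j w)) r s"
      using less.IH[of m1 j r s] less.prems s m 2 by simp
    moreover have "ret A (rev (take k w)) s q"
      using less.IH[of m2 k s q] less.prems s m 2 by simp
    ultimately show ?thesis using 2 ret_eq by (auto intro: cross.left)
  qed
qed

lemma steps_imp_front:
  assumes "wf_twodfa A"
  shows "k \<le> length w \<Longrightarrow> (step_upto A w k ^^ m) (init A, 0) (q, Suc k) \<Longrightarrow> front A (rev (take k w)) q"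
proof (induction k arbitrary: m q)
  case 0
  then show ?case using steps_imp_ret[OF assms, of 0] by simp
next
  case (Suc k)
  obtain m1 m2 r where r: "(step_upto A w k ^^ m1) (init A, 0) (r, Suc k)"
    "(step_upto A w (Suc k) ^^ m2) (r, Suc k) (q, Suc (Suc k))"
    using first_crossing[OF assms _ _ Suc.prems(2), of k] by auto
  have "front A (rev (take k w)) r" using Suc r by simp
  moreover have "ret A (rev (take (Suc k) w)) r q"
    using steps_imp_ret[OF assms Suc.prems(1) r(2)] .
  ultimately show ?case using Suc.prems by (auto simp: rev_take_Suc)
qed

text \<open>Since the head halts on \<open>REnd\<close>, its first arrival there is the last
  configuration, and no run re-enters the word from the right.\<close>

lemma accepts_iff_front:
  assumes wf: "wf_twodfa A" and halt: "\<And>q. delta A q REnd = None"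
  shows "accepts A w \<longleftrightarrow> set w \<subseteq> Sigma A \<and> (\<exists>q \<in> Final A. front A (rev w) q)"
proof -
  have "front A (rev w) q" if "(step A w)\<^sup>*\<^sup>* (init A, 0) (q, Suc (length w))" for q
  proof -
    have "(step_upto A w (length w))\<^sup>*\<^sup>* (init A, 0) c \<and> snd c \<le> Suc (length w)"
      if "(step A w)\<^sup>*\<^sup>* (init A, 0) c" for c
      using that
    proof induction
      case base
      then show ?case by simp
    next
      case (step c c')
      have "snd c \<noteq> Suc (length w)"
        using step.hyps(2) halt by (auto simp: step_def tape_def)
      moreover have "snd c' \<le> Suc (length w)"
        using step.hyps(2) by (auto simp: step_def)
      ultimately show ?case
        using step by (auto simp: step_upto_def intro: rtranclp.rtrancl_into_rtrancl)
    qed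
    then obtain m where "(step_upto A w (length w) ^^ m) (init A, 0) (q, Suc (length w))"
      using \<open>(step A w)\<^sup>*\<^sup>* (init A, 0) (q, Suc (length w))\<close> by (blast dest: rtranclp_imp_relpowp)
    then show ?thesis using steps_imp_front[OF wf, of "length w" w m q] by simp
  qed
  then show ?thesis
    using front_imp_steps[of "length w" w A] unfolding accepts_def by auto
qed

section \<open>The letters\<close>

text \<open>A letter is a list \<open>rs\<close> with \<open>length rs \<le> N\<close>: a state below
  \<open>length rs\<close> is blocked, passed to the right, or passed to the left, as its entry says. The state
  \<open>length rs\<close> asks the prefix whether its request \<open>Suc (length rs)\<close> is answered by \<open>N\<close>.\<close>

definition letter_trans :: "nat \<Rightarrow> bool option list \<Rightarrow> nat \<Rightarrow> (nat \<times> int) option" where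
  "letter_trans N rs q =
     (if q < length rs then map_option (\<lambda>r. (q, if r then 1 else -1)) (rs ! q)
      else if q = N then Some (min (Suc (length rs)) N, 1)
      else if q = length rs then Some (Suc q, -1)
      else None)"

text \<open>Three layers: \<open>exit_right\<close> allows no move to the left,
  \<open>exit_asking\<close> at most a request, and \<open>next_ret\<close> a pass to the left
  before that.\<close>

definition exit_right :: "nat \<Rightarrow> bool option list \<Rightarrow> nat \<Rightarrow> nat option" where
  "exit_right N rs q =
     (if q < length rs then (if rs ! q = Some True then Some q else None)
      else if q = N then Some (min (Suc (length rs)) N)
      else None)"

definition exit_asking :: "nat \<Rightarrow> bool option list \<Rightarrow> (nat \<Rightarrow> nat option) \<Rightarrow> nat \<Rightarrow> nat option" where
  "exit_asking N rs f q =
     (if q = length rs \<and> q < N then Option.bind (f (Suc q)) (exit_right N rs) else exit_right N rs q)"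

definition next_ret :: "nat \<Rightarrow> bool option list \<Rightarrow> (nat \<Rightarrow> nat option) \<Rightarrow> nat \<Rightarrow> nat option" where
  "next_ret N rs f q =
     (if q < length rs \<and> rs ! q = Some False then Option.bind (f q) (exit_asking N rs f)
      else exit_asking N rs f q)"

text \<open>Every state in which the head leaves a letter to the right is, at this letter, either passed
  to the right or blocked. This makes return functions idempotent wherever defined.\<close>

definition idem :: "(nat \<Rightarrow> nat option) \<Rightarrow> nat \<Rightarrow> bool" where
  "idem f q \<longleftrightarrow> f q = None \<or> f q = Some q"

text \<open>An exit state is either passed to the right, hence fixed, or
  \<open>min (Suc (length rs)) N\<close>, which is blocked unless it is \<open>N\<close>, and then
  fixed.\<close>

lemma idem_next_ret:
  assumes "length rs \<le> N" "next_ret N rs f p = Some q"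
  shows "idem (next_ret N rs f) q"
proof -
  have "\<exists>s. exit_right N rs s = Some q"
    using assms(2) unfolding next_ret_def exit_asking_def
    by (auto split: if_splits bind_splits)
  then show ?thesis
    using assms(1) unfolding idem_def next_ret_def exit_asking_def exit_right_def
    by (auto split: if_splits)
qed

text \<open>Further moves to the left cannot help: an answer is idempotent, so passing it to the
  left again yields the same state or nothing.\<close>

lemma cross_imp_next_ret:
  assumes len: "length rs \<le> N"
    and fg: "\<And>p q. g p q \<Longrightarrow> f p = Some q"
    and idem: "\<And>p q. f p = Some q \<Longrightarrow> idem f q"
    and "cross (letter_trans N rs) g p q"
  shows "next_ret N rs f p = Some q"
  using assms(4)
proof induction
  case (right p q)
  then show ?case
    unfolding letter_trans_def next_ret_def exit_asking_def exit_right_def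
    by (auto split: if_splits)
next
  case (left p p' p'' q)
  have f: "f p' = Some p''" using fg left by blast
  then have "idem f p''" using idem by blast
  then have nl: "\<not> (p'' < length rs \<and> rs ! p'' = Some False)"
    using left.IH unfolding idem_def next_ret_def exit_asking_def exit_right_def
    by (auto split: if_splits)
  then have e: "exit_asking N rs f p'' = Some q"
    using left.IH by (simp add: next_ret_def split: if_split_asm)
  consider "p < length rs" "rs ! p = Some False" "p' = p" | "p = length rs" "p < N" "p' = Suc p"
    using left.hyps(1) len unfolding letter_trans_def by (fastforce split: if_splits)
  then show ?case
  proof cases
    case 1
    then show ?thesis using f e unfolding next_ret_def by simp
  next
    case 2
    have "p'' \<noteq> p"
      using e f 2 unfolding exit_asking_def exit_right_def by auto
    then show ?thesis
      using e f 2 unfolding next_ret_def exit_asking_def by auto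
  qed
qed

lemma next_ret_leftD:
  assumes "k < length rs" "length rs \<le> N" "next_ret N rs f k = Some s" "s \<noteq> k"
  shows "rs ! k = Some False" "\<exists>r. f k = Some r \<and> exit_asking N rs f r = Some s"
proof -
  show *: "rs ! k = Some False"
    using assms by (auto simp: next_ret_def exit_asking_def exit_right_def split: if_split_asm)
  show "\<exists>r. f k = Some r \<and> exit_asking N rs f r = Some s"
    using assms(1,3) * by (simp add: next_ret_def bind_eq_Some_conv)
qed

section \<open>The potential\<close>

text \<open>Here \<open>k = N - d\<close>: \<open>potR\<close> measures the progress of the request \<open>k\<close> towards the answer \<open>N\<close>, and
  \<open>potY\<close> that of the head from \<open>k\<close> to \<open>N\<close>. Once the head, or the answer to \<open>k\<close>, is beyond
  \<open>k\<close>, the subtask for the request \<open>Suc k\<close> is complete, which is worth \<open>weight d\<close>.\<close>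

fun weight :: "nat \<Rightarrow> nat" where
  "weight 0 = 2"
| "weight (Suc d) = 3 * 2 ^ d"

fun potR :: "nat \<Rightarrow> nat \<Rightarrow> (nat \<Rightarrow> nat option) \<Rightarrow> nat"
  and potY :: "nat \<Rightarrow> nat \<Rightarrow> nat \<Rightarrow> (nat \<Rightarrow> nat option) \<Rightarrow> nat" where
  "potR N 0 f = (if f N = Some N then 1 else 0)"
| "potR N (Suc d) f =
     (case f (N - Suc d) of
        None \<Rightarrow> potR N d f
      | Some q \<Rightarrow> if N - Suc d < q then weight d + potY N d q f else potR N d f)"
| "potY N 0 q f = 0"
| "potY N (Suc d) q f = (if q = N - Suc d then potR N d f else weight d + potY N d q f)"

lemma weight_Suc: "0 < d \<Longrightarrow> weight (Suc d) = 2 * weight d"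
  by (cases d) simp_all

text \<open>An unfinished \<open>potR\<close> counts less than \<open>weight d\<close>, so going on
  to the \<open>potY\<close> subtask never lowers the potential.\<close>

lemma pot_less:
  "potR N d f < weight d" "potY N d q f < (if d = 0 then 1 else weight d)"
proof (induction d arbitrary: q)
  case (Suc d)
  have s: "weight d + potY N d q f < weight (Suc d)" for q
    using Suc.IH(2)[of q] by (cases "d = 0") (simp_all add: weight_Suc del: weight.simps(2), simp)
  have "potR N d f < weight (Suc d)"
    using Suc.IH(1) by (cases d) simp_all
  note s = s this
  { case 1 show ?case using s by (auto split: option.split simp del: weight.simps) }
  { case 2 show ?case using s by (simp del: weight.simps) }
qed simp_all

lemma potY_top: "d \<le> N \<Longrightarrow> Suc (potY N d N f) = (if d = 0 then 1 else weight d)"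
proof (induction d)
  case (Suc d)
  then show ?case
    by (cases "d = 0") (auto simp: weight_Suc simp del: weight.simps(2), simp_all)
qed simp

lemma potR_eq_0:
  "d \<le> N \<Longrightarrow> f N \<noteq> Some N \<Longrightarrow> (\<And>k. N - d \<le> k \<Longrightarrow> k < N \<Longrightarrow> f k = None) \<Longrightarrow> potR N d f = 0"
  by (induction d) simp_all

lemma potR_mono: "potR N d f \<le> potR N (Suc d) f"
  using pot_less(1)[of N d f] by (auto split: option.split)

text \<open>Compare \<open>k = N - Suc d\<close> with \<open>c = length rs\<close>. If
  \<open>c < k\<close>, no progress remains at this level. If \<open>c = k\<close>, a gain of
  \<open>weight d\<close> requires \<open>f (Suc k) = Some N\<close>, and then all but one of it is
  already present. If \<open>k < c\<close>, the letter only passes or blocks \<open>k\<close>, and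
  the induction hypothesis covers the states above.\<close>

lemma pot_next_ret:
  assumes len: "length rs \<le> N" and idem: "\<And>p q. f p = Some q \<Longrightarrow> idem f q"
  shows "d \<le> N \<Longrightarrow> potR N d (next_ret N rs f) \<le> Suc (potR N d f)"
    and "d \<le> N \<Longrightarrow> N - d \<le> q \<Longrightarrow> N - d \<le> q' \<Longrightarrow> idem f q \<Longrightarrow> next_ret N rs f q = Some q' \<Longrightarrow>
           potY N d q' (next_ret N rs f) \<le> Suc (potY N d q f)"
proof (induction d arbitrary: q q')
  case 0
  { case 1 show ?case by simp }
  { case 2 show ?case by simp }
next
  case (Suc d)
  define f' where "f' = next_ret N rs f"
  define k where "k = N - Suc d"
  define c where "c = length rs"
  note defs = f'_def c_def next_ret_def exit_asking_def exit_right_def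
  have above: "f' j = None" if "c < j" "j < N" for j
    using that unfolding defs by auto
  have top: "f' N = Some (Suc c)" if "c < N"
    using that unfolding defs by auto
  have IH_R: "potR N d f' \<le> Suc (potR N d f)" if "Suc d \<le> N"
    using Suc.IH(1) that unfolding f'_def by simp
  have IH_Y: "potY N d s' f' \<le> Suc (potY N d s f)"
    if "Suc d \<le> N" "k < s" "k < s'" "idem f s" "f' s = Some s'" for s s'
    using Suc.IH(2)[of s s'] that unfolding f'_def k_def by simp
  have kN: "k < N" "Suc k = N - d" if "Suc d \<le> N"
    using that unfolding k_def by simp_all
  have R': "potR N (Suc d) h = (case h k of None \<Rightarrow> potR N d h
      | Some q \<Rightarrow> if k < q then weight d + potY N d q h else potR N d h)" for h
    unfolding k_def by simp
  have Y': "potY N (Suc d) s h = (if s = k then potR N d h else weight d + potY N d s h)" for s h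
    unfolding k_def by simp
  have R0: "potR N d f' = 0" if "Suc d \<le> N" "c \<le> k" "Suc c < N"
    using that kN above top by (intro potR_eq_0) auto
  \<comment> \<open>The letter blocks the states strictly between \<open>k\<close> and
    \<open>N\<close>, so the new subtask starts at zero.\<close>
  have Y0: "potY N d (Suc k) f' = 0" if "Suc d \<le> N" "c = k"
  proof (cases d)
    case (Suc d')
    then have "Suc k = N - Suc d'" "Suc c < N" using that kN by simp_all
    moreover from this have "potR N d' f' = 0"
      using that Suc above top by (intro potR_eq_0) auto
    ultimately show ?thesis using Suc by simp
  qed simp
  \<comment> \<open>A complete answer gives \<open>potR\<close> its largest value,
    \<open>weight d - 1\<close>.\<close>
  have full: "weight d \<le> Suc (potR N d f)" if "Suc d \<le> N" "f (Suc k) = Some N"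
  proof (cases d)
    case 0
    then show ?thesis using that kN by simp
  next
    case (Suc d')
    then have "Suc (potR N d f) = weight d' + Suc (potY N d' N f)"
      using that kN by simp
    also have "\<dots> = weight d"
      using potY_top[of d' N f] that Suc by (cases "d' = 0") (simp_all add: weight_Suc del: weight.simps(2), simp)
    finally show ?thesis by simp
  qed
  have ask: "f (Suc k) = Some N \<and> s = Suc k" if "Suc d \<le> N" "c = k" "f' k = Some s" "k \<le> s" for s
    using that kN unfolding defs by (auto split: bind_splits if_splits)
  { case 1
    note kN = kN[OF 1]
    show ?case
    proof (cases "\<exists>s. f' k = Some s \<and> k < s")
      case False
      then have "potR N (Suc d) f' = potR N d f'"
        unfolding R' by (auto split: option.split)
      then show ?thesis
        using IH_R[OF 1] potR_mono[of N d f] unfolding f'_def by simp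
    next
      case True
      then obtain s where s: "f' k = Some s" "k < s" by blast
      have f': "potR N (Suc d) f' = weight d + potY N d s f'"
        unfolding R' using s by simp
      consider "c < k" | "c = k" | "k < c" by linarith
      then show ?thesis
      proof cases
        case 1
        then show ?thesis using s above kN by auto
      next
        case 2
        then have "f (Suc k) = Some N" "s = Suc k"
          using ask[OF 1] s by auto
        then show ?thesis
          using f' Y0[OF 1 2] full[OF 1] potR_mono[of N d f] unfolding f'_def by simp
      next
        case 3
        then obtain r where r: "rs ! k = Some False" "f k = Some r" "exit_asking N rs f r = Some s"
          using next_ret_leftD[OF _ len, of k f s] s unfolding f'_def c_def by auto
        have "\<not> r \<le> k"
          using r s 3 by (auto simp: c_def exit_asking_def exit_right_def split: if_split_asm)
        then have "k < r" by simp
        moreover have "\<not> (r < length rs \<and> rs ! r = Some False)"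
          using r by (auto simp: exit_asking_def exit_right_def)
        then have "f' r = Some s"
          using r unfolding f'_def next_ret_def by auto
        ultimately have "potY N d s f' \<le> Suc (potY N d r f)"
          using IH_Y[OF 1 _ s(2)] r idem by blast
        moreover have "potR N (Suc d) f = weight d + potY N d r f"
          unfolding R' using r \<open>k < r\<close> by simp
        ultimately show ?thesis using f' unfolding f'_def by simp
      qed
    qed
  }
  { case 2
    note kN = kN[OF 2(1)]
    have q: "k \<le> q" "k \<le> q'" "f' q = Some q'"
      using 2 unfolding k_def f'_def by simp_all
    consider "c < k" | "c = k" "q = k" | "c = k" "k < q" | "k < c" "q = k" | "k < c" "k < q"
      using q by linarith
    then have "potY N (Suc d) q' f' \<le> Suc (potY N (Suc d) q f)"
    proof cases
      case 1
      then have "q = N"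
        using q unfolding defs by (auto split: if_splits)
      then have "q' = Suc c" using q top 1 kN by simp
      then have "q' = k" using q 1 by simp
      then show ?thesis using R0[OF 2(1)] 1 kN Y' by simp
    next
      case c: 2
      then have "f (Suc k) = Some N" "q' = Suc k"
        using ask[OF 2(1)] q by auto
      then show ?thesis
        using c Y0[OF 2(1)] full[OF 2(1)] Y' by simp
    next
      case 3
      then have "q = N"
        using q unfolding defs by (auto split: if_splits)
      then have "q' = Suc k" using q top 3 kN by simp
      then show ?thesis using 3 Y0[OF 2(1)] Y' by simp
    next
      case 4
      \<comment> \<open>If \<open>k\<close> were passed to the left, \<open>idem f q\<close> would
        allow only \<open>k\<close> as the answer, and the head would not exit.\<close>
      then have "q' = k"
        using q 2(4) unfolding defs idem_def by (auto split: if_splits bind_splits)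
      then show ?thesis using 4 IH_R[OF 2(1)] Y' by simp
    next
      case 5
      show ?thesis
      proof (cases "q' = k")
        case True
        then show ?thesis using 5 pot_less(1)[of N d f'] Y' by simp
      next
        case False
        then show ?thesis using 5 q IH_Y[OF 2(1), of q q'] 2(4) Y' by simp
      qed
    qed
    then show ?case unfolding f'_def by simp
  }
qed

section \<open>The automaton\<close>

definition letters :: "nat \<Rightarrow> nat set" where
  "letters N = to_nat ` {rs :: bool option list. length rs \<le> N}"

text \<open>On \<open>LEnd\<close> only state 0 survives, so the empty prefix answers no other
  request.\<close>

definition aut :: "nat \<Rightarrow> twodfa" where
  "aut N = \<lparr>Sigma = letters N, States = {..N}, init = 0,
     delta = (\<lambda>q x. case x of
         LEnd \<Rightarrow> if q = 0 then Some (0, 1) else None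
       | REnd \<Rightarrow> None
       | Letter a \<Rightarrow> if q \<le> N \<and> a \<in> letters N then letter_trans N (from_nat a) q else None),
     Final = {N}\<rparr>"

lemma aut_simps [simp]:
  "Sigma (aut N) = letters N" "States (aut N) = {..N}" "init (aut N) = 0" "Final (aut N) = {N}"
  "delta (aut N) q LEnd = (if q = 0 then Some (0, 1) else None)"
  "delta (aut N) q REnd = None"
  by (simp_all add: aut_def)

lemma delta_aut_letter:
  "length rs \<le> N \<Longrightarrow>
     delta (aut N) q (Letter (to_nat rs)) = (if q \<le> N then letter_trans N rs q else None)"
  by (simp add: aut_def letters_def)

lemma letter_trans_bounds:
  "letter_trans N rs q = Some (r, d) \<Longrightarrow> length rs \<le> N \<Longrightarrow> q \<le> N \<Longrightarrow> r \<le> N \<and> (d = -1 \<or> d = 1)"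
  by (auto simp: letter_trans_def split: if_split_asm)

lemma wf_aut: "wf_twodfa (aut N)"
proof -
  have "finite {rs :: bool option list. length rs \<le> N}"
    using finite_lists_length_le[of "UNIV :: bool option set" N] by simp
  then have "finite (letters N)" by (simp add: letters_def)
  moreover have "q \<le> N \<and> c \<in> {LEnd, REnd} \<union> Letter ` letters N \<and> r \<le> N \<and> d \<in> {-1, 1}"
    if "delta (aut N) q c = Some (r, d)" for q c r d
  proof (cases c)
    case (Letter a)
    then have a: "q \<le> N" "a \<in> letters N" "letter_trans N (from_nat a) q = Some (r, d)"
      using that by (auto simp: aut_def split: if_split_asm)
    then have "length (from_nat a :: bool option list) \<le> N"
      by (auto simp: letters_def)
    then show ?thesis using a Letter letter_trans_bounds by blast
  qed (use that in \<open>auto split: if_split_asm\<close>)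
  ultimately show ?thesis
    unfolding wf_twodfa_def by simp
qed

section \<open>Lower bound on the length of accepted words\<close>

lemma cross_mono:
  assumes "cross t g p q" "\<And>p x. t p = Some x \<Longrightarrow> t' p = Some x"
  shows "cross t' g p q"
  using assms(1) by induction (auto intro: assms(2) cross.intros)

lemma ret_aut_Nil: "ret (aut N) [] p q \<longleftrightarrow> p = 0 \<and> q = 0"
  by (auto elim: cross.cases intro: cross.right split: if_split_asm)

text \<open>The potential starts at zero and each letter adds at most one. The function
  \<open>f\<close> only bounds \<open>ret\<close> from above, which suffices here.\<close>

lemma front_aut_bound:
  assumes "0 < N" "set u \<subseteq> letters N"
  shows "\<exists>f. (\<forall>p q. ret (aut N) u p q \<longrightarrow> f p = Some q) \<and> (\<forall>p q. f p = Some q \<longrightarrow> idem f q) \<and>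
             (\<forall>q. front (aut N) u q \<longrightarrow> idem f q \<and> potY N N q f \<le> length u)"
  using assms(2)
proof (induction u)
  case Nil
  define f :: "nat \<Rightarrow> nat option" where "f = (\<lambda>p. if p = 0 then Some 0 else None)"
  obtain d where d: "N = Suc d" using assms(1) by (cases N) auto
  have "potR N d f = 0"
    by (rule potR_eq_0) (auto simp: f_def d)
  then have "potY N N 0 f = 0" by (simp add: d)
  then show ?case
    by (intro exI[of _ f]) (auto simp: ret_aut_Nil idem_def f_def simp del: ret.simps)
next
  case (Cons a u)
  then obtain f where f: "\<And>p q. ret (aut N) u p q \<Longrightarrow> f p = Some q"
    "\<And>p q. f p = Some q \<Longrightarrow> idem f q"
    "\<And>q. front (aut N) u q \<Longrightarrow> idem f q \<and> potY N N q f \<le> length u"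
    by auto
  obtain rs :: "bool option list" where rs: "length rs \<le> N" "a = to_nat rs"
    using Cons.prems by (auto simp: letters_def)
  have ret: "next_ret N rs f p = Some q" if "ret (aut N) (a # u) p q" for p q
  proof (rule cross_imp_next_ret[OF rs(1) f(1,2)])
    show "cross (letter_trans N rs) (ret (aut N) u) p q"
      by (rule cross_mono[OF that[unfolded ret.simps]])
        (auto simp: rs delta_aut_letter split: if_split_asm)
  qed
  have "idem (next_ret N rs f) q \<and> potY N N q (next_ret N rs f) \<le> length (a # u)"
    if fr: "front (aut N) (a # u) q" for q
  proof -
    obtain p where p: "front (aut N) u p" "next_ret N rs f p = Some q"
      using fr ret by auto
    have "potY N N q (next_ret N rs f) \<le> Suc (potY N N p f)"
      using pot_next_ret(2)[OF rs(1) f(2), where d = N and q = p and q' = q] f(3) p by simp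
    then show ?thesis
      using f(3)[OF p(1)] idem_next_ret[OF rs(1) p(2)] by simp
  qed
  then show ?case
    using ret idem_next_ret[OF rs(1)] by (intro exI[of _ "next_ret N rs f"]) auto
qed

lemma accepts_aut_length:
  assumes "0 < N" "accepts (aut N) w"
  shows "3 * 2 ^ (N - 1) - 1 \<le> length w"
proof -
  have w: "set (rev w) \<subseteq> letters N" "front (aut N) (rev w) N"
    using assms(2) by (simp_all add: accepts_iff_front[OF wf_aut])
  obtain f where "potY N N N f \<le> length w"
    using front_aut_bound[OF assms(1) w(1)] w(2) by auto
  moreover have "Suc (potY N N N f) = 3 * 2 ^ (N - 1)"
    using potY_top[of N N f] assms(1) by (cases N) auto
  ultimately show ?thesis by linarith
qed

section \<open>The accepted word\<close>

text \<open>With \<open>d = N - length rs\<close>, the appended entry is the role of state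
  \<open>length rs\<close> in a subtask: \<open>None\<close> when idle, \<open>Some True\<close> to
  carry the head to the asking letter \<open>rs\<close>, \<open>Some False\<close> to carry the
  request back to it.\<close>

fun wordR :: "nat \<Rightarrow> bool option list \<Rightarrow> bool option list list"
  and wordY :: "nat \<Rightarrow> bool option list \<Rightarrow> bool option list list" where
  "wordR 0 rs = [rs]"
| "wordR (Suc d) rs = wordR d (rs @ [None]) @ rs # wordY d (rs @ [Some False])"
| "wordY 0 rs = []"
| "wordY (Suc d) rs = wordR d (rs @ [Some True]) @ rs # wordY d (rs @ [None])"

lemma length_words:
  "length (wordR d rs) = weight d - 1" "Suc (length (wordY d rs)) = (if d = 0 then 1 else weight d)"
proof (induction d arbitrary: rs)
  case (Suc d)
  have "Suc (length (wordR d rs) + Suc (length (wordY d rs'))) = weight (Suc d)" for rs rs'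
    using Suc.IH(1)[of rs] Suc.IH(2)[of rs'] by (cases d) simp_all
  note s = this
  { case 1 show ?case using s[of "rs @ [None]" "rs @ [Some False]"] by (simp del: weight.simps) }
  { case 2 show ?case using s[of "rs @ [Some True]" "rs @ [None]"] by (simp del: weight.simps) }
qed simp_all

lemma words_extend:
  "rs' \<in> set (wordR d rs) \<Longrightarrow> \<exists>ys. rs' = rs @ ys \<and> length ys \<le> d"
  "rs' \<in> set (wordY d rs) \<Longrightarrow> \<exists>ys. rs' = rs @ ys \<and> length ys \<le> d"
proof (induction d arbitrary: rs)
  case (Suc d)
  have s: "\<exists>ys. rs' = rs @ ys \<and> length ys \<le> Suc d"
    if "rs' \<in> set (wordR d (rs @ [x])) \<or> rs' = rs \<or> rs' \<in> set (wordY d (rs @ [y]))" for rs x y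
    using that Suc.IH(1)[of "rs @ [x]"] Suc.IH(2)[of "rs @ [y]"] by auto
  { case 1 then show ?case using s[of rs None "Some False"] by auto }
  { case 2 then show ?case using s[of rs "Some True" None] by auto }
qed simp_all

text \<open>The recursion only appends to letters, so the role of state \<open>length rs\<close> is
  constant throughout a block.\<close>

lemma words_role:
  assumes "rs' \<in> set (wordR d (rs @ [x])) \<or> rs' \<in> set (wordY d (rs @ [x]))"
  shows "length rs < length rs'" "rs' ! length rs = x" "length rs' \<le> Suc (length rs + d)"
  using assms words_extend[of rs' d "rs @ [x]"] by auto

lemma ret_aut_right:
  assumes "length rs \<le> N" "p \<le> N" "letter_trans N rs p = Some (q, 1)"
  shows "ret (aut N) (to_nat rs # u) p q"
  using assms by (auto simp: delta_aut_letter intro: cross.right)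

lemma ret_aut_left:
  assumes "length rs \<le> N" "p \<le> N" "letter_trans N rs p = Some (p', -1)"
    "ret (aut N) u p' p''" "ret (aut N) (to_nat rs # u) p'' q"
  shows "ret (aut N) (to_nat rs # u) p q"
  using assms by (auto simp: delta_aut_letter intro: cross.left)

lemma ret_aut_ask:
  fixes rs :: "bool option list"
  assumes "length rs < N" "ret (aut N) u (Suc (length rs)) N"
  shows "ret (aut N) (to_nat rs # u) (length rs) (Suc (length rs))"
proof (rule ret_aut_left[OF _ _ _ assms(2)])
  show "ret (aut N) (to_nat rs # u) N (Suc (length rs))"
    using assms by (intro ret_aut_right) (simp_all add: letter_trans_def)
qed (use assms in \<open>simp_all add: letter_trans_def\<close>)

text \<open>A predicate is driven by a set of letters if it follows the state of a head that crosses
  them from left to right. The front state is one instance; the answer to a request that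
  all letters pass to the left is the other.\<close>

definition driven :: "nat \<Rightarrow> bool option list set \<Rightarrow> (nat list \<Rightarrow> nat \<Rightarrow> bool) \<Rightarrow> bool" where
  "driven N W P \<longleftrightarrow>
     (\<forall>rs\<in>W. \<forall>u p q. P u p \<longrightarrow> ret (aut N) (to_nat rs # u) p q \<longrightarrow> P (to_nat rs # u) q)"

lemma driven_subset: "driven N W P \<Longrightarrow> W' \<subseteq> W \<Longrightarrow> driven N W' P"
  unfolding driven_def by blast

lemma driven_ret:
  assumes "\<And>rs. rs \<in> W \<Longrightarrow> k < length rs \<and> length rs \<le> N \<and> rs ! k = Some False"
  shows "driven N W (\<lambda>u. ret (aut N) u k)"
  unfolding driven_def
proof (intro ballI allI impI)
  fix rs u p q
  assume "rs \<in> W" "ret (aut N) u k p" "ret (aut N) (to_nat rs # u) p q"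
  then show "ret (aut N) (to_nat rs # u) k q"
    using assms[of rs] by (intro ret_aut_left[of rs N k k u p q]) (simp_all add: letter_trans_def)
qed

lemma driven_stay:
  assumes "driven N (set ws) P" "P u k"
    "\<And>rs. rs \<in> set ws \<Longrightarrow> k < length rs \<and> length rs \<le> N \<and> rs ! k = Some True"
  shows "P (rev (map to_nat ws) @ u) k"
  using assms
proof (induction ws arbitrary: u)
  case (Cons rs ws)
  have "ret (aut N) (to_nat rs # u) k k"
    using Cons.prems(3)[of rs] by (intro ret_aut_right) (auto simp: letter_trans_def)
  then have "P (to_nat rs # u) k"
    using Cons.prems(1,2) unfolding driven_def by simp
  then show ?case
    using Cons.IH[of "to_nat rs # u"] Cons.prems driven_subset[OF Cons.prems(1)] by auto
qed simp

text \<open>The general \<open>P\<close> lets the second part follow the front state or, inside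
  \<open>wordR\<close>, the answer to the request \<open>length rs\<close>.\<close>

lemma words_run:
  "length rs + d = N \<Longrightarrow> ret (aut N) (rev (map to_nat (wordR d rs)) @ u) (length rs) N"
  "length rs + d = N \<Longrightarrow> driven N (set (wordY d rs)) P \<Longrightarrow> P u (length rs) \<Longrightarrow>
     P (rev (map to_nat (wordY d rs)) @ u) N"
proof (induction d arbitrary: rs u P)
  case 0
  { case 1
    then show ?case by (auto simp: letter_trans_def intro!: ret_aut_right simp del: ret.simps) }
  { case 2
    then show ?case by simp }
next
  case (Suc d)
  have ask: "ret (aut N) (to_nat rs # rev (map to_nat (wordR d (rs @ [x]))) @ u)
      (length rs) (Suc (length rs))"
    if "length rs + Suc d = N" for rs x u
    using that Suc.IH(1)[of "rs @ [x]" u] by (intro ret_aut_ask) simp_all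
  { case 1
    have "driven N (set (wordY d (rs @ [Some False]))) (\<lambda>u. ret (aut N) u (length rs))"
      using words_role[of _ d rs "Some False"] 1 by (intro driven_ret) fastforce
    then have "ret (aut N) (rev (map to_nat (wordY d (rs @ [Some False]))) @
        to_nat rs # rev (map to_nat (wordR d (rs @ [None]))) @ u) (length rs) N"
      using Suc.IH(2)[of "rs @ [Some False]" "\<lambda>u. ret (aut N) u (length rs)"] ask[OF 1] 1
      by simp
    then show ?case by simp }
  { case 2
    have "P (rev (map to_nat (wordR d (rs @ [Some True]))) @ u) (length rs)"
      using words_role[of _ d rs "Some True"] 2
      by (intro driven_stay[OF driven_subset[OF 2(2)]]) fastforce+
    then have "P (to_nat rs # rev (map to_nat (wordR d (rs @ [Some True]))) @ u) (Suc (length rs))"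
      using ask[OF 2(1)] 2(2) unfolding driven_def by simp
    moreover have "driven N (set (wordY d (rs @ [None]))) P"
      by (rule driven_subset[OF 2(2)]) auto
    ultimately show ?case
      using Suc.IH(2)[of "rs @ [None]" P] 2(1) by simp }
qed

lemma accepts_aut_word: "accepts (aut N) (map to_nat (wordY N []))"
proof -
  have "driven N (set (wordY N [])) (front (aut N))"
    unfolding driven_def by auto
  then have "front (aut N) (rev (map to_nat (wordY N [])) @ []) N"
    by (rule words_run(2)[rotated]) (simp_all add: ret_aut_Nil del: ret.simps)
  moreover have "to_nat rs \<in> letters N" if "rs \<in> set (wordY N [])" for rs
    using words_extend(2)[OF that] by (auto simp: letters_def)
  ultimately show ?thesis
    by (auto simp: accepts_iff_front[OF wf_aut])
qed

theorem theorem4: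
  fixes n :: nat
  assumes "n \<ge> 2"
  shows "\<exists>A. wf_twodfa A \<and> card (States A) = n \<and> (\<exists>w. accepts A w) \<and>
           (\<exists>w. accepts A w \<and> length w = 3 * 2 ^ (n - 2) - 1 \<and>
                (\<forall>w'. accepts A w' \<longrightarrow> length w \<le> length w'))"
proof -
  obtain m where n: "n = Suc (Suc m)"
    using assms by (metis add_2_eq_Suc le_Suc_ex)
  \<comment> \<open>The states from 0 to \<open>Suc m\<close> are \<open>n\<close> in number, and
    \<open>weight (Suc m)\<close> is \<open>3 * 2 ^ (n - 2)\<close>.\<close>
  let ?A = "aut (Suc m)" and ?w = "map to_nat (wordY (Suc m) [])"
  have len: "length ?w = 3 * 2 ^ (n - 2) - 1"
    using length_words(2)[of "Suc m" "[]"] n by (simp del: wordY.simps)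
  have "length ?w \<le> length w'" if "accepts ?A w'" for w'
    using accepts_aut_length[OF _ that] len n by simp
  moreover have "card (States ?A) = n" by (simp add: n)
  ultimately show ?thesis
    using wf_aut accepts_aut_word len by blast
qed

end
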